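(* Let $E\subset\mathbb{R}^2$ be a closed set with a finite number of connected components and such that $\mathrm{Int}\,E\neq\varnothing$. If $E$ is weakly $1$-convex, then $\mathrm{Int}\,E$ is weakly $1$-convex.
   Context: $\mathrm{Int}\,E$ denotes the interior of $E$. A set $E\subset\mathbb{R}^2$ is $1$-convex with respect to a point $x\in\mathbb{R}^2\setminus E$ if there exists a straight line $L$ with $x\in L$ and $L\cap E=\varnothing$. An open set $G\subset\mathbb{R}^2$ is weakly $1$-convex if it is $1$-convex with respect to every point $x\in\partial G$. A set $A$ is approximated from the outside by a family of open sets $A_k$, $k=1,2,\ldots$, if $\overline{A_{k+1}}\subset A_k$ for all $k$ and $A=\bigcap_k A_k$. A closed set $E\subset\mathbb{R}^2$ is weakly $1$-convex if it can be approximated from the outside by a family of open weakly $1$-convex sets $A_k$, $k=1,2,\ldots$. *)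

theory Defs
  imports "HOL-Analysis.Analysis"
begin

definition straight_line :: "(real^2) set \<Rightarrow> bool" where
  "straight_line L \<longleftrightarrow> affine L \<and> aff_dim L = 1"

(* The requirement that x lies outside E need not be stated: it follows from
   x \<in> L and L \<inter> E = {}. *)
definition one_convex_wrt :: "(real^2) set \<Rightarrow> real^2 \<Rightarrow> bool" where
  "one_convex_wrt E x \<longleftrightarrow> (\<exists>L. straight_line L \<and> x \<in> L \<and> L \<inter> E = {})"

definition open_weakly_one_convex :: "(real^2) set \<Rightarrow> bool" where
  "open_weakly_one_convex G \<longleftrightarrow> open G \<and> (\<forall>x\<in>frontier G. one_convex_wrt G x)"

(* Families are indexed from 0 rather than from 1. *)
definition approximated_from_outside :: "(real^2) set \<Rightarrow> (nat \<Rightarrow> (real^2) set) \<Rightarrow> bool" where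
  "approximated_from_outside A F \<longleftrightarrow>
     (\<forall>k. open (F k)) \<and> (\<forall>k. closure (F (Suc k)) \<subseteq> F k) \<and> A = (\<Inter>k. F k)"

definition closed_weakly_one_convex :: "(real^2) set \<Rightarrow> bool" where
  "closed_weakly_one_convex E \<longleftrightarrow>
     closed E \<and> (\<exists>F. approximated_from_outside E F \<and> (\<forall>k. open_weakly_one_convex (F k)))"

end

theory Submission
  imports Defs
begin

text \<open>A frontier point \<open>x\<close> of \<open>interior E\<close> lies in every approximating set and is a limit of points
  outside \<open>E\<close>. A short segment from \<open>x\<close> to such a point crosses the frontier of some
  approximating set, and there a line avoiding that set, hence \<open>E\<close>, is available. So lines avoiding
  \<open>E\<close> pass arbitrarily close to \<open>x\<close>; by compactness of the unit circle their directions
  subconverge, and the limit line avoids the open set \<open>interior E\<close>.\<close>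

text \<open>Describing a line by a base point and a unit direction puts the choice of line into a
  compact set, from which convergent subsequences can be drawn.\<close>

lemma one_convex_wrt_iff_direction:
  "one_convex_wrt A y \<longleftrightarrow> (\<exists>v. norm v = 1 \<and> (\<forall>t. y + t *\<^sub>R v \<notin> A))"
proof
  assume "one_convex_wrt A y"
  then obtain L where L: "affine L" "aff_dim L = 1" "y \<in> L" "L \<inter> A = {}"
    by (auto simp: one_convex_wrt_def straight_line_def)
  have "L \<noteq> {y}" using L(2) by auto
  then obtain z where z: "z \<in> L" "z \<noteq> y" using L(3) by blast
  have "y + t *\<^sub>R sgn (z - y) \<notin> A" for t
  proof -
    \<comment> \<open>Dividing by the norm turns arc length \<open>t\<close> along the unit
      direction into the affine coordinate relative to \<open>y\<close> and
      \<open>z\<close>.\<close>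
    let ?s = "t / norm (z - y)"
    have "(1 - ?s) *\<^sub>R y + ?s *\<^sub>R z \<in> L"
      using L(1,3) z(1) by (simp add: affine_alt)
    moreover have "(1 - ?s) *\<^sub>R y + ?s *\<^sub>R z = y + t *\<^sub>R sgn (z - y)"
      by (simp add: sgn_div_norm algebra_simps divide_inverse)
    ultimately show ?thesis using L(4) by auto
  qed
  moreover have "norm (sgn (z - y)) = 1" using z(2) by (simp add: norm_sgn)
  ultimately show "\<exists>v. norm v = 1 \<and> (\<forall>t. y + t *\<^sub>R v \<notin> A)" by blast
next
  assume "\<exists>v. norm v = 1 \<and> (\<forall>t. y + t *\<^sub>R v \<notin> A)"
  then obtain v where v: "norm v = 1" "\<And>t. y + t *\<^sub>R v \<notin> A" by blast
  let ?L = "affine hull {y, y + v}"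
  have "y \<noteq> y + v" using v(1) by auto
  then have "straight_line ?L"
    unfolding straight_line_def by (metis aff_dim_2 aff_dim_affine_hull affine_affine_hull)
  moreover have "y \<in> ?L" by (simp add: hull_inc)
  moreover have "?L \<inter> A = {}"
  proof -
    have "p \<notin> A" if p: "p \<in> ?L" for p
    proof -
      obtain a b where ab: "p = a *\<^sub>R y + b *\<^sub>R (y + v)" "a + b = 1"
        using p by (auto simp: affine_hull_2)
      have "p = (a + b) *\<^sub>R y + b *\<^sub>R v"
        unfolding ab(1) scaleR_add_left scaleR_add_right by (rule add.assoc[symmetric])
      then have "p = y + b *\<^sub>R v" unfolding ab(2) scaleR_one .
      then show ?thesis using v(2) by simp
    qed
    then show ?thesis by blast
  qed
  ultimately show "one_convex_wrt A y" unfolding one_convex_wrt_def by blast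
qed

text \<open>For each fixed parameter \<open>t\<close>, the points at \<open>t\<close> on the lines
  of the subsequence converge, and they stay in the complement of \<open>G\<close>, which is
  closed.\<close>

lemma one_convex_wrt_limit:
  assumes "open G" and "y \<longlonglongrightarrow> x" and "\<And>n. one_convex_wrt G (y n)"
  shows "one_convex_wrt G x"
proof -
  obtain v where v: "\<And>n. norm (v n) = 1" "\<And>n t. y n + t *\<^sub>R v n \<notin> G"
    using assms(3) unfolding one_convex_wrt_iff_direction by metis
  obtain w r where w: "norm w = 1" and r: "strict_mono r" "(v \<circ> r) \<longlonglongrightarrow> w"
    using compact_sphere[of "0 :: real^2" 1] v(1)
    unfolding compact_def by (metis mem_sphere_0)
  have "x + t *\<^sub>R w \<notin> G" for t
  proof -
    have "(\<lambda>n. (y \<circ> r) n + t *\<^sub>R (v \<circ> r) n) \<longlonglongrightarrow> x + t *\<^sub>R w"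
      using LIMSEQ_subseq_LIMSEQ[OF assms(2) r(1)] r(2) by (intro tendsto_intros)
    then have "x + t *\<^sub>R w \<in> - G"
      by (rule closed_sequentially[rotated 2]) (use assms(1) v(2) in \<open>auto simp: closed_Compl\<close>)
    then show ?thesis by simp
  qed
  then show ?thesis using w unfolding one_convex_wrt_iff_direction by blast
qed

lemma one_convex_wrt_mono:
  "one_convex_wrt B x \<Longrightarrow> A \<subseteq> B \<Longrightarrow> one_convex_wrt A x"
  unfolding one_convex_wrt_def by blast

lemma closed_weakly_one_convex_near_frontier:
  assumes "closed_weakly_one_convex E" and "x \<in> frontier E" and "0 < e"
  shows "\<exists>y. dist y x < e \<and> one_convex_wrt E y"
proof -
  obtain F :: "nat \<Rightarrow> (real^2) set" where F: "E = (\<Inter>k. F k)" "\<And>k. open_weakly_one_convex (F k)"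
    using assms(1) unfolding closed_weakly_one_convex_def approximated_from_outside_def by metis
  have "x \<in> E"
    using assms(1,2) by (auto simp: closed_weakly_one_convex_def frontier_def)
  obtain z where z: "z \<notin> E" "dist x z < e"
    using assms(2,3) by (auto simp: frontier_straddle)
  obtain k where k: "z \<notin> F k" using z(1) F(1) by blast
  \<comment> \<open>The segment is connected and joins \<open>x\<close>, which lies in
    \<open>F k\<close>, to \<open>z\<close>, which does not.\<close>
  have "closed_segment x z \<inter> frontier (F k) \<noteq> {}"
    using \<open>x \<in> E\<close> F(1) k by (intro connected_Int_frontier) auto
  then obtain y where y: "y \<in> closed_segment x z" "y \<in> frontier (F k)" by blast
  have "dist y x < e"
    using dist_in_closed_segment(1)[OF y(1)] z(2) by (simp add: dist_commute)
  moreover have "one_convex_wrt (F k) y"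
    using F(2) y(2) by (auto simp: open_weakly_one_convex_def)
  then have "one_convex_wrt E y"
    by (rule one_convex_wrt_mono) (use F(1) in blast)
  ultimately show ?thesis by blast
qed

theorem theorem3:
  fixes E :: "(real^2) set"
  assumes "closed E"
    and "finite (components E)"
    and "interior E \<noteq> {}"
    and "closed_weakly_one_convex E"
  shows "open_weakly_one_convex (interior E)"
  unfolding open_weakly_one_convex_def
proof (intro conjI ballI)
  show "open (interior E)" by simp
  fix x assume "x \<in> frontier (interior E)"
  then have "x \<in> frontier E" using frontier_interior_subset by blast
  then have "\<exists>y. dist y x < 1 / Suc n \<and> one_convex_wrt E y" for n
    using assms(4) by (intro closed_weakly_one_convex_near_frontier) auto
  then obtain y where y: "\<And>n. dist (y n) x < 1 / Suc n" "\<And>n. one_convex_wrt E (y n)"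
    by metis
  have "y \<longlonglongrightarrow> x"
  proof (rule tendsto_dist_iff[THEN iffD2], rule Lim_null_comparison)
    show "\<forall>\<^sub>F n in sequentially. norm (dist (y n) x) \<le> inverse (real (Suc n))"
      using less_imp_le[OF y(1)] by (simp add: inverse_eq_divide)
    show "(\<lambda>n. inverse (real (Suc n))) \<longlonglongrightarrow> 0"
      by (rule LIMSEQ_inverse_real_of_nat)
  qed
  \<comment> \<open>A limit of lines missing the closed set \<open>E\<close> may touch
    \<open>E\<close>, so the lines are first weakened to miss the open set
    \<open>interior E\<close>; that property survives the limit.\<close>
  then show "one_convex_wrt (interior E) x"
    using one_convex_wrt_mono[OF y(2) interior_subset] by (rule one_convex_wrt_limit[OF open_interior])
qed

end
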